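(* Let $G$ be a topological group which is topologically generated by a subset $E\subset G$, and let $f\in C(G)$. Assume that for each $h\in E$ there is a positive integer $n(h)$ with $\Delta_h^{n(h)}f=0$. If (a) $E$ consists of compact elements, or (b) $G$ is commutative and $E$ is finite, then $f\in(SP)=(P)$; that is, the spaces $(SP)$ and $(P)$ on $G$ coincide and $f$ belongs to them.
   Context: $C(G)$ is the space of continuous functions $f:G\to\mathbb{C}$. For $h\in G$, $(\Delta_hf)(x)=f(xh)-f(x)$. $(P_n)$ is the set of $f\in C(G)$ with $\Delta_{h_{n+1}}\cdots\Delta_{h_1}f=0$ for all $h_1,\dots,h_{n+1}\in G$, and $(SP_n)$ is the set of $f\in C(G)$ with $\Delta_h^{n+1}f=0$ for all $h\in G$; $(P)=\bigcup_{n\ge0}(P_n)$ and $(SP)=\bigcup_{n\ge0}(SP_n)$. A subset $E$ topologically generates $G$ if the subgroup generated by $E$ is dense in $G$. An element $h\in G$ is compact if the closure of the cyclic subgroup generated by $h$ is compact. *)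

theory Defs
  imports "HOL-Analysis.Analysis" "HOL-Algebra.Generated_Groups"
begin

text \<open>No separation axiom is imposed on the topology.\<close>

locale topological_group = group G for G (structure) +
  fixes T :: "'a topology"
  assumes topspace_eq_carrier: "topspace T = carrier G"
    and continuous_mult: "continuous_map (prod_topology T T) T (\<lambda>(x, y). x \<otimes> y)"
    and continuous_inv: "continuous_map T T (\<lambda>x. inv x)"

definition topologically_generates :: "('a, 'b) monoid_scheme \<Rightarrow> 'a topology \<Rightarrow> 'a set \<Rightarrow> bool" where
  "topologically_generates G T E \<longleftrightarrow> T closure_of (generate G E) = carrier G"

definition compact_element :: "('a, 'b) monoid_scheme \<Rightarrow> 'a topology \<Rightarrow> 'a \<Rightarrow> bool" where
  "compact_element G T h \<longleftrightarrow> compactin T (T closure_of (generate G {h}))"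

text \<open>
  A function on the group is represented by a total function on the ambient type. Only its
  values on the carrier matter, so equations between functions are stated pointwise on the carrier.
\<close>

definition cfun :: "'a topology \<Rightarrow> ('a \<Rightarrow> complex) set" where
  "cfun T = {f. continuous_map T euclidean f}"

definition diff_op :: "('a, 'b) monoid_scheme \<Rightarrow> 'a \<Rightarrow> ('a \<Rightarrow> complex) \<Rightarrow> 'a \<Rightarrow> complex" where
  "diff_op G h f = (\<lambda>x. f (x \<otimes>\<^bsub>G\<^esub> h) - f x)"

text \<open>
  For \<open>hs = [h\<^sub>1, \<dots>, h\<^sub>n\<^sub>+\<^sub>1]\<close>, \<open>fold (diff_op G) hs f\<close> applies the
  difference with step \<open>h\<^sub>1\<close> first.
\<close>

definition P_deg :: "('a, 'b) monoid_scheme \<Rightarrow> 'a topology \<Rightarrow> nat \<Rightarrow> ('a \<Rightarrow> complex) set" where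
  "P_deg G T n = {f \<in> cfun T. \<forall>hs. length hs = n + 1 \<and> set hs \<subseteq> carrier G \<longrightarrow>
     (\<forall>x\<in>carrier G. fold (diff_op G) hs f x = 0)}"

definition SP_deg :: "('a, 'b) monoid_scheme \<Rightarrow> 'a topology \<Rightarrow> nat \<Rightarrow> ('a \<Rightarrow> complex) set" where
  "SP_deg G T n = {f \<in> cfun T. \<forall>h\<in>carrier G. \<forall>x\<in>carrier G. (diff_op G h ^^ (n + 1)) f x = 0}"

definition P_space :: "('a, 'b) monoid_scheme \<Rightarrow> 'a topology \<Rightarrow> ('a \<Rightarrow> complex) set" where
  "P_space G T = (\<Union>n. P_deg G T n)"

definition SP_space :: "('a, 'b) monoid_scheme \<Rightarrow> 'a topology \<Rightarrow> ('a \<Rightarrow> complex) set" where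
  "SP_space G T = (\<Union>n. SP_deg G T n)"

end

(*
  For continuous g, the elements h with diff_op G h g = 0 form a closed subgroup of G, so such
  an identity extends from E to all of G.

  In case (a), the orbit m \<mapsto> g (x h^m) of a function killed by the second difference is affine,
  and it is bounded since h is compact; hence the first difference already vanishes. So every
  f as in the theorem is constant.

  In case (b), sufficiently many differences with steps in the finite set E kill f, since some
  step must occur often enough; the steps are then moved one at a time from E to all of G.

  In both cases this places f in (P), and the hypothesis on f holds for every member of (SP).
*)

theory Submission
  imports Defs
begin

context topological_group
begin

section \<open>Continuity, and identities on the carrier\<close>

lemma continuous_mult_left:
  assumes "x \<in> carrier G"
  shows "continuous_map T T (\<lambda>u. x \<otimes> u)"
proof -
  have "continuous_map T (prod_topology T T) (\<lambda>u. (x, u))"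
    using assms by (simp add: continuous_map_pairwise o_def topspace_eq_carrier)
  from continuous_map_compose[OF this continuous_mult] show ?thesis
    by (simp add: o_def)
qed

lemma continuous_mult_right:
  assumes "x \<in> carrier G"
  shows "continuous_map T T (\<lambda>u. u \<otimes> x)"
proof -
  have "continuous_map T (prod_topology T T) (\<lambda>u. (u, x))"
    using assms by (simp add: continuous_map_pairwise o_def topspace_eq_carrier)
  from continuous_map_compose[OF this continuous_mult] show ?thesis
    by (simp add: o_def)
qed

lemma cfun_left_translate:
  assumes "g \<in> cfun T" "x \<in> carrier G"
  shows "continuous_map T euclidean (\<lambda>u. g (x \<otimes> u))"
  using continuous_map_compose[OF continuous_mult_left[OF assms(2)], of euclidean g] assms(1)
  by (simp add: cfun_def o_def)

lemma diff_op_cfun: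
  assumes "g \<in> cfun T" "h \<in> carrier G"
  shows "diff_op G h g \<in> cfun T"
  using continuous_map_compose[OF continuous_mult_right[OF assms(2)], of euclidean g] assms(1)
  by (auto simp: cfun_def diff_op_def o_def intro!: continuous_map_diff)

lemma fold_diff_op_cfun:
  assumes "g \<in> cfun T" "set hs \<subseteq> carrier G"
  shows "fold (diff_op G) hs g \<in> cfun T"
  using assms by (induction hs arbitrary: g) (auto intro: diff_op_cfun)

lemma diff_op_cong:
  assumes "\<forall>x\<in>carrier G. f x = g x" "h \<in> carrier G" "x \<in> carrier G"
  shows "diff_op G h f x = diff_op G h g x"
  using assms by (simp add: diff_op_def)

text \<open>Identities between differences hold only on the carrier, so they are not equations of
  functions. This congruence replaces rewriting underneath \<open>fold\<close>.\<close>

lemma fold_diff_op_cong: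
  assumes "\<forall>x\<in>carrier G. f x = g x" "set hs \<subseteq> carrier G" "x \<in> carrier G"
  shows "fold (diff_op G) hs f x = fold (diff_op G) hs g x"
  using assms
proof (induction hs arbitrary: f g)
  case (Cons h hs)
  show ?case
    using Cons.prems by (simp, intro Cons.IH) (auto intro: diff_op_cong)
qed simp

lemma fold_diff_op_eq_0:
  assumes "\<forall>x\<in>carrier G. f x = 0" "set hs \<subseteq> carrier G" "x \<in> carrier G"
  shows "fold (diff_op G) hs f x = 0"
  using assms
proof (induction hs arbitrary: f)
  case (Cons h hs)
  show ?case
    using Cons.prems by (simp, intro Cons.IH) (auto simp: diff_op_def)
qed simp

section \<open>From generators to the whole group\<close>

lemma diff_op_eq_0_closure:
  assumes "E \<subseteq> carrier G" "topologically_generates G T E" "g \<in> cfun T"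
    and E: "\<forall>h\<in>E. \<forall>x\<in>carrier G. diff_op G h g x = 0"
    and h: "h \<in> carrier G" and x: "x \<in> carrier G"
  shows "diff_op G h g x = 0"
proof -
  have inv: "u \<in> carrier G \<and> (\<forall>x\<in>carrier G. g (x \<otimes> u) = g x)" if "u \<in> generate G E" for u
    using that
  proof (induction rule: generate.induct)
    case (incl h)
    then show ?case using E \<open>E \<subseteq> carrier G\<close> by (auto simp: diff_op_def)
  next
    case (inv h)
    have "g (x \<otimes> inv h) = g x" if "x \<in> carrier G" for x
    proof -
      have "h \<in> carrier G" using inv \<open>E \<subseteq> carrier G\<close> by auto
      \<comment> \<open>Taking the base point \<open>x \<otimes> inv h\<close> makes the difference
        compare \<open>g x\<close> with \<open>g (x \<otimes> inv h)\<close>.\<close>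
      moreover from this have "diff_op G h g (x \<otimes> inv h) = 0"
        using E inv that by blast
      ultimately show ?thesis
        using that by (simp add: diff_op_def m_assoc)
    qed
    then show ?case using inv \<open>E \<subseteq> carrier G\<close> by auto
  next
    case (eng h1 h2)
    then show ?case by (simp add: m_assoc[symmetric])
  qed auto
  \<comment> \<open>For fixed \<open>x\<close> this is the preimage of a point under a continuous
    map. Being closed and containing the generated subgroup, it contains the closure, which is all
    of \<open>G\<close>.\<close>
  have "closedin T {u \<in> topspace T. g (x \<otimes> u) \<in> {g x}}"
    by (rule closedin_continuous_map_preimage[OF cfun_left_translate[OF \<open>g \<in> cfun T\<close> x]]) simp
  moreover have "generate G E \<subseteq> {u \<in> topspace T. g (x \<otimes> u) \<in> {g x}}"
    using inv x by (auto simp: topspace_eq_carrier)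
  ultimately have "T closure_of generate G E \<subseteq> {u \<in> topspace T. g (x \<otimes> u) \<in> {g x}}"
    by (simp add: closure_of_minimal)
  then show ?thesis
    using h assms(2) by (auto simp: topologically_generates_def diff_op_def)
qed

section \<open>Compact elements\<close>

lemma affine_along_orbit:
  assumes "\<forall>x\<in>carrier G. diff_op G h (diff_op G h g) x = 0"
    and h: "h \<in> carrier G" and x: "x \<in> carrier G"
  shows "g (x \<otimes> h [^] (m::nat)) = g x + of_nat m * diff_op G h g x"
proof -
  \<comment> \<open>The zero second difference makes the first one constant along the orbit; summing
    these equal increments gives the affine formula.\<close>
  have const: "diff_op G h g (x \<otimes> h [^] m) = diff_op G h g x" for m :: nat
  proof (induction m)
    case (Suc m)
    have "diff_op G h g (x \<otimes> h [^] m \<otimes> h) = diff_op G h g (x \<otimes> h [^] m)"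
      using assms(1) h x by (auto simp: diff_op_def[of G h "diff_op G h g"])
    then show ?case using Suc h x by (simp add: m_assoc)
  qed (use x in simp)
  show ?thesis
  proof (induction m)
    case (Suc m)
    have "g (x \<otimes> h [^] m \<otimes> h) = g (x \<otimes> h [^] m) + diff_op G h g (x \<otimes> h [^] m)"
      by (simp add: diff_op_def)
    then show ?case using Suc const[of m] h x by (simp add: m_assoc algebra_simps)
  qed (use x in simp)
qed

text \<open>The orbit values lie in a continuous image of the compact closure of the cyclic
  subgroup, so they are bounded; an affine sequence with nonzero slope is not.\<close>

lemma compact_diff_op_step:
  assumes g: "g \<in> cfun T" and h: "h \<in> carrier G" and cpt: "compact_element G T h"
    and 2: "\<forall>x\<in>carrier G. diff_op G h (diff_op G h g) x = 0" and x: "x \<in> carrier G"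
  shows "diff_op G h g x = 0"
proof (rule ccontr)
  assume nz: "diff_op G h g x \<noteq> 0"
  let ?K = "T closure_of (generate G {h})"
  have "compactin euclidean ((\<lambda>u. g (x \<otimes> u)) ` ?K)"
    using cpt cfun_left_translate[OF g x]
    unfolding compact_element_def by (rule image_compactin)
  then have "bounded ((\<lambda>u. g (x \<otimes> u)) ` ?K)"
    by (simp add: compact_imp_bounded)
  then obtain B where B: "norm (g (x \<otimes> u)) \<le> B" if "u \<in> ?K" for u
    by (auto simp: bounded_iff)
  have "generate G {h} \<subseteq> ?K"
    using h by (intro closure_of_subset) (simp add: topspace_eq_carrier generate_incl)
  moreover have "h [^] (m::nat) \<in> generate G {h}" for m
    by (induction m) (auto intro: generate.intros)
  ultimately have bound: "norm (g (x \<otimes> h [^] (m::nat))) \<le> B" for m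
    using B by blast
  \<comment> \<open>By the triangle inequality, \<open>B + norm (g x)\<close> bounds the total
    increment after any number of steps; the Archimedean property gives an \<open>m\<close>
    exceeding it.\<close>
  obtain m :: nat where m: "B + norm (g x) < of_nat m * norm (diff_op G h g x)"
    using ex_less_of_nat_mult[of "norm (diff_op G h g x)"] nz by auto
  have "of_nat m * diff_op G h g x = g (x \<otimes> h [^] m) - g x"
    using affine_along_orbit[OF 2 h x] by simp
  then have "of_nat m * norm (diff_op G h g x) \<le> norm (g (x \<otimes> h [^] m)) + norm (g x)"
    by (metis norm_mult norm_of_nat norm_triangle_ineq4)
  with m bound[of m] show False by linarith
qed

text \<open>The order drops by one at a time: for \<open>n + 2\<close> vanishing differences, the
  previous lemma is applied to the \<open>n\<close>-th difference of \<open>g\<close>, leaving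
  \<open>n + 1\<close>.\<close>

lemma compact_diff_op_eq_0:
  assumes "g \<in> cfun T" "h \<in> carrier G" "compact_element G T h"
    and "\<forall>x\<in>carrier G. (diff_op G h ^^ Suc n) g x = 0"
  shows "\<forall>x\<in>carrier G. diff_op G h g x = 0"
  using assms
proof (induction n)
  case (Suc n)
  have "(diff_op G h ^^ n) g \<in> cfun T"
    unfolding fold_replicate[symmetric] using Suc.prems by (intro fold_diff_op_cfun) auto
  then show ?case
    using Suc compact_diff_op_step[of "(diff_op G h ^^ n) g" h] by simp
qed simp

lemma mem_P_of_compact:
  assumes "E \<subseteq> carrier G" "topologically_generates G T E" "f \<in> cfun T"
    and ann: "\<forall>h\<in>E. \<exists>n>0. \<forall>x\<in>carrier G. (diff_op G h ^^ n) f x = 0"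
    and cpt: "\<forall>h\<in>E. compact_element G T h"
  shows "f \<in> P_space G T"
proof -
  have "\<forall>x\<in>carrier G. diff_op G h f x = 0" if h: "h \<in> E" for h
  proof -
    obtain n where "\<forall>x\<in>carrier G. (diff_op G h ^^ Suc n) f x = 0"
      using ann h gr0_conv_Suc by metis
    then show ?thesis
      using compact_diff_op_eq_0 assms(1,3) cpt h by blast
  qed
  then have "diff_op G h f x = 0" if "h \<in> carrier G" "x \<in> carrier G" for h x
    using diff_op_eq_0_closure assms(1-3) that by blast
  \<comment> \<open>Degree 0 concerns lists of length one, that is, single differences.\<close>
  then have "f \<in> P_deg G T 0"
    using assms(3) by (auto simp: P_deg_def length_Suc_conv)
  then show ?thesis by (auto simp: P_space_def)
qed

section \<open>Commutative groups\<close>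

lemma diff_op_commute:
  assumes "comm_group G" "h \<in> carrier G" "k \<in> carrier G" "x \<in> carrier G"
  shows "diff_op G h (diff_op G k f) x = diff_op G k (diff_op G h f) x"
proof -
  interpret comm_group G by fact
  show ?thesis using assms by (simp add: diff_op_def m_ac)
qed

lemma fold_diff_op_commute:
  assumes "comm_group G" "k \<in> carrier G" "set hs \<subseteq> carrier G" "x \<in> carrier G"
  shows "fold (diff_op G) hs (diff_op G k f) x = diff_op G k (fold (diff_op G) hs f) x"
  using assms(3)
proof (induction hs arbitrary: f)
  case (Cons h hs)
  have "fold (diff_op G) hs (diff_op G h (diff_op G k f)) x =
        fold (diff_op G) hs (diff_op G k (diff_op G h f)) x"
    using Cons.prems assms by (intro fold_diff_op_cong) (auto intro: diff_op_commute)
  with Cons show ?case by simp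
qed simp

text \<open>This is the pigeonhole principle run as an induction: \<open>sum n E\<close> is a
  budget, and each step \<open>h\<close> lowers \<open>n h\<close> by one as \<open>f\<close>
  becomes \<open>diff_op G h f\<close>. The extra 1 in the length leaves one more step once the
  budget is spent.\<close>

lemma fold_diff_op_eq_0_of_powers:
  assumes comm: "comm_group G" and E: "E \<subseteq> carrier G" "finite E"
    and "\<forall>h\<in>E. \<forall>x\<in>carrier G. (diff_op G h ^^ n h) f x = 0"
    and "set hs \<subseteq> E" "length hs = Suc (sum n E)" "x \<in> carrier G"
  shows "fold (diff_op G) hs f x = 0"
  using assms(4-6)
proof (induction hs arbitrary: n f)
  case (Cons h hs)
  then have h: "h \<in> E" by simp
  show ?case
  proof (cases "n h")
    case 0
    \<comment> \<open>The zeroth power is the identity, so the budget of \<open>h\<close> is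
      exhausted only if the current function already vanishes.\<close>
    with Cons.prems h have "\<forall>x\<in>carrier G. f x = 0" by auto
    then show ?thesis
      using Cons.prems E \<open>x \<in> carrier G\<close> fold_diff_op_eq_0[of f "h # hs" x] by blast
  next
    case (Suc m)
    let ?n = "n(h := m)"
    have "sum n E = Suc (sum ?n E)"
      using h E Suc by (simp add: sum.remove[of E h])
    moreover have "(diff_op G k ^^ ?n k) (diff_op G h f) y = 0"
      if k: "k \<in> E" and y: "y \<in> carrier G" for k y
    proof (cases "k = h")
      case True
      then show ?thesis
        using Cons.prems(1) h y Suc by (auto simp: funpow_Suc_right simp del: funpow.simps)
    next
      case False
      \<comment> \<open>Commutativity lets the other steps keep their exponents:
        \<open>diff_op G h\<close> is moved outside and acts on a function that is zero on the
        carrier.\<close>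
      have "(diff_op G k ^^ n k) (diff_op G h f) y = diff_op G h ((diff_op G k ^^ n k) f) y"
        unfolding fold_replicate[symmetric]
        using comm E h k y by (intro fold_diff_op_commute) auto
      also have "\<dots> = 0"
        using Cons.prems(1) E h k y by (auto simp: diff_op_def[of G h])
      finally show ?thesis using False by simp
    qed
    ultimately show ?thesis
      using Cons.IH[of ?n "diff_op G h f"] Cons.prems by simp
  qed
qed simp

text \<open>Steps are freed by induction on their number, with \<open>f\<close> arbitrary. For
  \<open>k\<close> in \<open>E\<close> the hypothesis passes to \<open>diff_op G k f\<close> with
  one step fewer, which frees the tail \<open>ks\<close>; the closure lemma applied to
  \<open>fold (diff_op G) ks f\<close> then frees the first step.\<close>

lemma fold_diff_op_eq_0_closure:
  assumes comm: "comm_group G" and E: "E \<subseteq> carrier G" "topologically_generates G T E"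
    and "f \<in> cfun T"
    and "\<And>hs x. set hs \<subseteq> E \<Longrightarrow> length hs = N \<Longrightarrow> x \<in> carrier G \<Longrightarrow> fold (diff_op G) hs f x = 0"
    and "set hs \<subseteq> carrier G" "length hs = N" "x \<in> carrier G"
  shows "fold (diff_op G) hs f x = 0"
  using assms(4-8)
proof (induction N arbitrary: f hs x)
  case (Suc N)
  then obtain h ks where hs: "hs = h # ks" "length ks = N" "h \<in> carrier G" "set ks \<subseteq> carrier G"
    by (auto simp: length_Suc_conv)
  have "diff_op G k (fold (diff_op G) ks f) y = 0" if k: "k \<in> E" and y: "y \<in> carrier G" for k y
  proof -
    have "fold (diff_op G) ks (diff_op G k f) y = 0"
    proof (rule Suc.IH)
      show "diff_op G k f \<in> cfun T" using Suc.prems(1) E k by (auto intro: diff_op_cfun)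
      show "fold (diff_op G) ls (diff_op G k f) z = 0"
        if "set ls \<subseteq> E" "length ls = N" "z \<in> carrier G" for ls z
        using Suc.prems(2)[of "k # ls" z] k that by simp
    qed (use hs y in auto)
    \<comment> \<open>The step \<open>k\<close> must come last for the closure lemma, hence the
      commutation here; it is undone for \<open>h\<close> at the end.\<close>
    then show ?thesis
      using fold_diff_op_commute[OF comm] E hs k y by auto
  qed
  then have "diff_op G h (fold (diff_op G) ks f) x = 0"
    using E hs Suc.prems(1,5) fold_diff_op_cfun by (intro diff_op_eq_0_closure[OF E]) auto
  then show ?case
    using fold_diff_op_commute[OF comm] hs Suc.prems(5) by auto
qed auto

lemma mem_P_of_comm:
  assumes "E \<subseteq> carrier G" "topologically_generates G T E" "f \<in> cfun T"
    and ann: "\<forall>h\<in>E. \<exists>n>0. \<forall>x\<in>carrier G. (diff_op G h ^^ n) f x = 0"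
    and "comm_group G" "finite E"
  shows "f \<in> P_space G T"
proof -
  obtain n where n: "\<forall>h\<in>E. \<forall>x\<in>carrier G. (diff_op G h ^^ n h) f x = 0"
    using ann by metis
  have "fold (diff_op G) hs f x = 0"
    if "set hs \<subseteq> E" "length hs = Suc (sum n E)" "x \<in> carrier G" for hs x
    using fold_diff_op_eq_0_of_powers assms(1,5,6) n that by blast
  from fold_diff_op_eq_0_closure[OF \<open>comm_group G\<close> assms(1-3) this]
  \<comment> \<open>The degree is one less than the list length
    \<open>Suc (sum n E)\<close>.\<close>
  have "f \<in> P_deg G T (sum n E)"
    using assms(3) by (simp add: P_deg_def)
  then show ?thesis by (auto simp: P_space_def)
qed

section \<open>Comparison of (P) and (SP)\<close>

lemma P_subset_SP: "P_space G T \<subseteq> SP_space G T"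
proof -
  have "g \<in> SP_deg G T n" if g: "g \<in> P_deg G T n" for g n
  proof -
    have "(diff_op G h ^^ (n + 1)) g x = 0" if "h \<in> carrier G" "x \<in> carrier G" for h x
    proof -
      \<comment> \<open>Equal steps turn the mixed difference into a power of one
        difference.\<close>
      have "length (replicate (n + 1) h) = n + 1 \<and> set (replicate (n + 1) h) \<subseteq> carrier G"
        using that by auto
      then show ?thesis
        using g that unfolding P_deg_def fold_replicate[symmetric] by blast
    qed
    then show ?thesis
      using g unfolding P_deg_def SP_deg_def by blast
  qed
  then show ?thesis by (auto simp: P_space_def SP_space_def)
qed

end

theorem theorem4p3:
  fixes G :: "('a, 'b) monoid_scheme" and T :: "'a topology"
    and E :: "'a set" and f :: "'a \<Rightarrow> complex"
  assumes "topological_group G T"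
    and "E \<subseteq> carrier G"
    and "topologically_generates G T E"
    and "f \<in> cfun T"
    and "\<forall>h\<in>E. \<exists>n>0. \<forall>x\<in>carrier G. (diff_op G h ^^ n) f x = 0"
    and "(\<forall>h\<in>E. compact_element G T h) \<or> (comm_group G \<and> finite E)"
  shows "f \<in> SP_space G T \<and> SP_space G T = P_space G T"
proof -
  interpret topological_group G T by fact
  \<comment> \<open>Stated for arbitrary \<open>g\<close>, since it serves both \<open>f\<close> and
    every member of (SP).\<close>
  have P: "g \<in> P_space G T" if "g \<in> cfun T"
    and "\<forall>h\<in>E. \<exists>n>0. \<forall>x\<in>carrier G. (diff_op G h ^^ n) g x = 0" for g
    using mem_P_of_compact[of E g] mem_P_of_comm[of E g] assms(2,3,6) that by blast
  have "SP_space G T \<subseteq> P_space G T"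
  proof
    fix g assume "g \<in> SP_space G T"
    then obtain n where n: "g \<in> cfun T"
      "\<forall>h\<in>carrier G. \<forall>x\<in>carrier G. (diff_op G h ^^ (n + 1)) g x = 0"
      by (auto simp: SP_space_def SP_deg_def)
    have "\<exists>n>0. \<forall>x\<in>carrier G. (diff_op G h ^^ n) g x = 0" if "h \<in> E" for h
      using n(2) assms(2) that by (intro exI[of _ "n + 1"]) auto
    then show "g \<in> P_space G T"
      using n(1) P by blast
  qed
  then show ?thesis
    using P[OF assms(4,5)] P_subset_SP by blast
qed

end
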